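(* A non-principal ultrafilter $\alpha$ on $\mathbb{N}$ is a P-point if and only if for every $f:\mathbb{N}\to\mathbb{N}$ that is not $\alpha$-constant there exists an $\alpha$-faithful $g:\mathbb{N}\to\mathbb{N}$ such that $g\ll f$.
   Context: A function $f:\mathbb{N}\to\mathbb{N}$ is $\alpha$-constant if there is $A\in\alpha$ such that $f|_A$ is constant. For $f:\mathbb{N}\to\mathbb{N}$ let $\alpha^f=\{A\subset\mathbb{N}:f^{-1}(A)\in\alpha\}$. A function $f:\mathbb{N}\to\mathbb{N}$ that is not $\alpha$-constant is called $\alpha$-faithful if there exists $K\in\alpha$ such that for every $A\subset\mathbb{N}$, $f[A\cap K]\in\alpha^f$ implies $A\cap K\in\alpha$. For $f,g:\mathbb{N}\to\mathbb{N}$, write $g\ll f$ if there is a strictly increasing $h:\mathbb{N}\to\mathbb{N}$ with $g\le h\circ f$ pointwise. The non-principal ultrafilter $\alpha$ is a P-point if for every partition $\{A_n:n\in\mathbb{N}\}$ of $\mathbb{N}$ with $A_n\notin\alpha$ for all $n$, there is $X\in\alpha$ such that $X\cap A_n$ is finite for each $n\in\mathbb{N}$. *)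

theory Defs
  imports "HOL-Analysis.Abstract_Topology_2" "HOL-Library.Disjoint_Sets"
begin

text \<open>
  Ultrafilters are represented by the library type of filters, which also contains the
  improper filter \<^term>\<open>bot\<close>. The set \<open>members \<alpha>\<close> is \<open>\<alpha>\<close> viewed as a family of sets.
\<close>

definition members :: "'a filter \<Rightarrow> 'a set set" where
  "members \<alpha> = {A. eventually (\<lambda>x. x \<in> A) \<alpha>}"

definition ultrafilter :: "'a filter \<Rightarrow> bool" where
  "ultrafilter \<alpha> \<longleftrightarrow> \<alpha> \<noteq> bot \<and> (\<forall>A. A \<in> members \<alpha> \<or> - A \<in> members \<alpha>)"

text \<open>\<^term>\<open>principal {n}\<close> is the filter of all sets containing \<open>n\<close>.\<close>

definition nonprincipal :: "'a filter \<Rightarrow> bool" where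
  "nonprincipal \<alpha> \<longleftrightarrow> (\<nexists>n. \<alpha> = principal {n})"

definition alpha_constant :: "nat filter \<Rightarrow> (nat \<Rightarrow> nat) \<Rightarrow> bool" where
  "alpha_constant \<alpha> f \<longleftrightarrow> (\<exists>A \<in> members \<alpha>. f constant_on A)"

text \<open>The image ultrafilter \<open>\<alpha>\<^sup>f\<close> is \<^term>\<open>filtermap f \<alpha>\<close>:\<close>

lemma members_filtermap: "members (filtermap f \<alpha>) = {A. f -` A \<in> members \<alpha>}"
  by (simp add: members_def eventually_filtermap)

definition alpha_faithful :: "nat filter \<Rightarrow> (nat \<Rightarrow> nat) \<Rightarrow> bool" where
  "alpha_faithful \<alpha> f \<longleftrightarrow> \<not> alpha_constant \<alpha> f \<and>
     (\<exists>K \<in> members \<alpha>. \<forall>A. f ` (A \<inter> K) \<in> members (filtermap f \<alpha>) \<longrightarrow> A \<inter> K \<in> members \<alpha>)"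

definition ll :: "(nat \<Rightarrow> nat) \<Rightarrow> (nat \<Rightarrow> nat) \<Rightarrow> bool"  (infix \<open>\<lless>\<close> 50) where
  "g \<lless> f \<longleftrightarrow> (\<exists>h :: nat \<Rightarrow> nat. strict_mono h \<and> (\<forall>n. g n \<le> (h \<circ> f) n))"

text \<open>
  The enumeration \<open>A\<close> may repeat pieces, so finite partitions are included; this is harmless,
  since some piece of a finite partition lies in any given ultrafilter.
\<close>

definition P_point :: "nat filter \<Rightarrow> bool" where
  "P_point \<alpha> \<longleftrightarrow>
     (\<forall>A :: nat \<Rightarrow> nat set. partition_on UNIV (range A) \<longrightarrow> (\<forall>n. A n \<notin> members \<alpha>) \<longrightarrow>
        (\<exists>X \<in> members \<alpha>. \<forall>n. finite (X \<inter> A n)))"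

end

theory Submission
  imports Defs
begin

text \<open>
  A map is faithful iff it is injective on a set of the ultrafilter: given a witness \<open>K\<close> of
  faithfulness, a transversal \<open>T \<subseteq> K\<close> of the fibres of \<open>f\<close> on \<open>K\<close> satisfies \<open>f[T] = f[K]\<close>, and
  hence belongs to \<open>\<alpha>\<close>. If \<open>\<alpha>\<close> is a P-point and \<open>f\<close> is not constant modulo \<open>\<alpha>\<close>, then \<open>f\<close> is
  finite-to-one on some \<open>X \<in> \<alpha>\<close>; the identity on \<open>X\<close>, extended by \<open>0\<close>, is then bounded by a
  function of \<open>f\<close>. Conversely, let \<open>f\<close> be the index function of a partition. If \<open>g \<le> h \<circ> f\<close> is
  injective on \<open>X \<in> \<alpha>\<close>, then \<open>X\<close> meets each piece in a finite set, as \<open>g\<close> is bounded there.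
\<close>

lemma members_mono: "A \<in> members \<alpha> \<Longrightarrow> A \<subseteq> B \<Longrightarrow> B \<in> members \<alpha>"
  unfolding members_def by (auto elim: eventually_mono)

lemma members_Int: "A \<in> members \<alpha> \<Longrightarrow> B \<in> members \<alpha> \<Longrightarrow> A \<inter> B \<in> members \<alpha>"
  unfolding members_def by (auto intro: eventually_conj)

lemma ultrafilter_empty: "ultrafilter \<alpha> \<Longrightarrow> {} \<notin> members \<alpha>"
  by (auto simp: ultrafilter_def members_def)

text \<open>A filter with \<open>{n}\<close> as a member contains every set through
  \<open>n\<close>; a member missing \<open>n\<close> would meet \<open>{n}\<close> in the empty
  set.\<close>

lemma nonprincipal_singleton:
  assumes "ultrafilter \<alpha>" "nonprincipal \<alpha>"
  shows "{n} \<notin> members \<alpha>"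
proof
  assume n: "{n} \<in> members \<alpha>"
  have "eventually P \<alpha> \<longleftrightarrow> P n" for P
  proof
    assume "eventually P \<alpha>"
    then have "{n} \<inter> Collect P \<in> members \<alpha>"
      using n by (intro members_Int) (auto simp: members_def)
    then show "P n"
      using ultrafilter_empty[OF assms(1)] by (cases "P n") auto
  next
    assume "P n"
    then have "Collect P \<in> members \<alpha>"
      using n by (auto intro: members_mono)
    then show "eventually P \<alpha>"
      by (simp add: members_def)
  qed
  then have "\<alpha> = principal {n}"
    by (simp add: filter_eq_iff eventually_principal)
  with assms(2) show False
    by (simp add: nonprincipal_def)
qed

lemma alpha_faithful_iff_inj_on:
  assumes "ultrafilter \<alpha>" "nonprincipal \<alpha>"
  shows "alpha_faithful \<alpha> f \<longleftrightarrow> (\<exists>X \<in> members \<alpha>. inj_on f X)"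
proof
  assume "alpha_faithful \<alpha> f"
  then obtain K where K: "K \<in> members \<alpha>"
    and faithful: "\<And>A. f ` (A \<inter> K) \<in> members (filtermap f \<alpha>) \<Longrightarrow> A \<inter> K \<in> members \<alpha>"
    unfolding alpha_faithful_def by blast
  obtain T where T: "T \<subseteq> K" "inj_on f T" "f ` K = f ` T"
    using subset_image_inj[of "f ` K" f K] by auto
  have "f -` (f ` T) \<in> members \<alpha>"
    using K by (rule members_mono) (simp add: T(3)[symmetric] image_subset_iff_subset_vimage[symmetric])
  then have "T \<in> members \<alpha>"
    using faithful[of T] T(1) by (simp add: members_filtermap Int_absorb2)
  with T(2) show "\<exists>X \<in> members \<alpha>. inj_on f X"
    by blast
next
  assume "\<exists>X \<in> members \<alpha>. inj_on f X"
  then obtain X where X: "X \<in> members \<alpha>" "inj_on f X"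
    by blast
  have "\<not> alpha_constant \<alpha> f"
  proof
    assume "alpha_constant \<alpha> f"
    then obtain B c where B: "B \<in> members \<alpha>" "\<And>x. x \<in> B \<Longrightarrow> f x = c"
      unfolding alpha_constant_def constant_on_def by blast
    have BX: "B \<inter> X \<in> members \<alpha>"
      using B(1) X(1) by (rule members_Int)
    then obtain n where "n \<in> B \<inter> X"
      using ultrafilter_empty[OF assms(1)] by (metis ex_in_conv)
    \<comment> \<open>\<open>f\<close> is both constant and injective on
      \<open>B \<inter> X\<close>.\<close>
    then have "B \<inter> X \<subseteq> {n}"
      using B(2) X(2) by (auto simp: inj_on_def)
    with BX show False
      using nonprincipal_singleton[OF assms] members_mono by blast
  qed
  moreover have "A \<inter> X \<in> members \<alpha>" if "f ` (A \<inter> X) \<in> members (filtermap f \<alpha>)" for A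
  proof -
    \<comment> \<open>\<open>X\<close> itself serves as the witness of faithfulness: by injectivity,
      a point of \<open>X\<close> whose value is taken on \<open>A \<inter> X\<close> lies in
      \<open>A\<close>.\<close>
    have "f -` f ` (A \<inter> X) \<inter> X \<in> members \<alpha>"
      using that X(1) by (intro members_Int) (simp_all add: members_filtermap)
    moreover have "f -` f ` (A \<inter> X) \<inter> X \<subseteq> A \<inter> X"
      using X(2) by (auto simp: inj_on_def)
    ultimately show ?thesis
      by (rule members_mono)
  qed
  ultimately show "alpha_faithful \<alpha> f"
    unfolding alpha_faithful_def using X(1) by blast
qed

lemma P_point_finite_to_one:
  assumes "P_point \<alpha>" "\<not> alpha_constant \<alpha> f"
  obtains X where "X \<in> members \<alpha>" "\<And>k. finite {x \<in> X. f x = k}"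
proof -
  \<comment> \<open>Fibres are indexed by points rather than values, so that no piece is empty, as
    \<open>partition_on\<close> demands; repetitions are harmless.\<close>
  define A where "A n = {x. f x = f n}" for n
  have "partition_on UNIV (range A)"
    by (auto simp: partition_on_def disjoint_def A_def)
  moreover have "A n \<notin> members \<alpha>" for n
    using assms(2) by (auto simp: alpha_constant_def constant_on_def A_def)
  ultimately obtain X where X: "X \<in> members \<alpha>" "\<And>n. finite (X \<inter> A n)"
    using assms(1) unfolding P_point_def by blast
  have "finite {x \<in> X. f x = k}" for k
  proof (cases "k \<in> range f")
    case True
    then obtain n where "k = f n" by blast
    then have "{x \<in> X. f x = k} = X \<inter> A n"
      by (auto simp: A_def)
    then show ?thesis using X(2) by simp
  next
    case False
    then have "{x \<in> X. f x = k} = {}" by auto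
    then show ?thesis by (simp only: finite.emptyI)
  qed
  with X(1) that show thesis by blast
qed

text \<open>Partial sums dominate \<open>H\<close> and are monotone; adding \<open>k\<close> makes
  them strictly increasing, as \<open>\<lless>\<close> requires.\<close>

lemma strict_mono_majorant:
  fixes H :: "nat \<Rightarrow> nat"
  obtains h :: "nat \<Rightarrow> nat" where "strict_mono h" "\<And>k. H k \<le> h k"
proof
  show "strict_mono (\<lambda>k. k + (\<Sum>i\<le>k. H i))"
    by (simp add: strict_mono_Suc_iff)
  show "H k \<le> k + (\<Sum>i\<le>k. H i)" for k
    using member_le_sum[of k "{..k}" H] by simp
qed

theorem corollary4:
  fixes \<alpha> :: "nat filter"
  assumes "ultrafilter \<alpha>" and "nonprincipal \<alpha>"
  shows "P_point \<alpha> \<longleftrightarrow>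
    (\<forall>f :: nat \<Rightarrow> nat. \<not> alpha_constant \<alpha> f \<longrightarrow>
       (\<exists>g :: nat \<Rightarrow> nat. alpha_faithful \<alpha> g \<and> g \<lless> f))"
proof (intro iffI allI impI)
  fix f :: "nat \<Rightarrow> nat"
  assume "P_point \<alpha>" "\<not> alpha_constant \<alpha> f"
  then obtain X where X: "X \<in> members \<alpha>" and fin: "\<And>k. finite {x \<in> X. f x = k}"
    using P_point_finite_to_one by blast
  define g where "g n = (if n \<in> X then n else 0)" for n
  \<comment> \<open>The sum of a finite set of naturals bounds each of its elements, and is also
    defined for an empty fibre.\<close>
  obtain h :: "nat \<Rightarrow> nat" where h: "strict_mono h" "\<And>k. \<Sum>{x \<in> X. f x = k} \<le> h k"
    using strict_mono_majorant[of "\<lambda>k. \<Sum>{x \<in> X. f x = k}"] by blast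
  have "g n \<le> h (f n)" for n
  proof (cases "n \<in> X")
    case True
    then have "n \<le> \<Sum>{x \<in> X. f x = f n}"
      using member_le_sum[OF _ _ fin, of n "f n" "\<lambda>x. x"] by simp
    then show ?thesis
      using h(2)[of "f n"] by (simp add: g_def)
  qed (simp add: g_def)
  then have "g \<lless> f"
    using h(1) by (auto simp: ll_def)
  moreover have "inj_on g X"
    by (simp add: inj_on_def g_def)
  then have "alpha_faithful \<alpha> g"
    using X alpha_faithful_iff_inj_on[OF assms] by blast
  ultimately show "\<exists>g. alpha_faithful \<alpha> g \<and> g \<lless> f"
    by blast
next
  assume faithful: "\<forall>f. \<not> alpha_constant \<alpha> f \<longrightarrow> (\<exists>g. alpha_faithful \<alpha> g \<and> g \<lless> f)"
  show "P_point \<alpha>"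
    unfolding P_point_def
  proof (intro allI impI)
    fix A :: "nat \<Rightarrow> nat set"
    assume part: "partition_on UNIV (range A)" and small: "\<forall>n. A n \<notin> members \<alpha>"
    \<comment> \<open>Pieces may repeat in the enumeration, so on \<open>A n\<close> the index
      \<open>f x\<close> can be smaller than \<open>n\<close>.\<close>
    define f where "f x = (LEAST i. x \<in> A i)" for x
    have f_mem: "x \<in> A (f x)" for x
    proof -
      have "\<exists>i. x \<in> A i"
        using part by (auto simp: partition_on_def)
      then show ?thesis
        unfolding f_def by (rule LeastI_ex)
    qed
    have f_le: "f x \<le> n" if "x \<in> A n" for x n
      unfolding f_def using that by (rule Least_le)
    have "\<not> alpha_constant \<alpha> f"
    proof
      assume "alpha_constant \<alpha> f"
      then obtain B c where "B \<in> members \<alpha>" "\<And>x. x \<in> B \<Longrightarrow> f x = c"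
        unfolding alpha_constant_def constant_on_def by blast
      then have "A c \<in> members \<alpha>"
        using f_mem by (metis members_mono subsetI)
      with small show False by blast
    qed
    with faithful obtain g where "alpha_faithful \<alpha> g" "g \<lless> f"
      by blast
    then obtain X h where X: "X \<in> members \<alpha>" "inj_on g X"
      and h: "strict_mono h" "\<And>n. g n \<le> h (f n)"
      unfolding alpha_faithful_iff_inj_on[OF assms] ll_def by auto
    have "finite (X \<inter> A n)" for n
    proof (rule inj_on_finite)
      show "inj_on g (X \<inter> A n)"
        using X(2) by (rule inj_on_subset) simp
      \<comment> \<open>On \<open>A n\<close>, \<open>f x \<le> n\<close> and monotonicity of
        \<open>h\<close> give \<open>g x \<le> h (f x) \<le> h n\<close>.\<close>
      show "g ` (X \<inter> A n) \<subseteq> {..h n}"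
        using f_le by (auto intro!: order_trans[OF h(2)] simp: strict_mono_less_eq[OF h(1)])
    qed simp
    with X(1) show "\<exists>X \<in> members \<alpha>. \<forall>n. finite (X \<inter> A n)"
      by blast
  qed
qed

end
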